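(* Let $X\subseteq\mathbb{R}^n$ be open, let $\bar x\in X$, let $I$ be a nonempty finite index set, and let $f:X\to\mathbb{R}$ be a continuous function of the form $f(x)=\min_{i\in I} f_i(x)$ for all $x\in X$, where each $f_i:X\to\mathbb{R}$ is Hadamard directionally differentiable at $\bar x$ with sublinear directional derivative $f_i'(\bar x;\cdot)$. Then $$\bigcup_{\substack{p\in \mathcal{S}\\ f'(\bar x;p)>0}}\ \bigcap_{i\in I(\bar x,p)}\ \operatorname*{Arg\,max}_{v\in\partial f_i(\bar x)}\langle v,p\rangle\ \subseteq\ \operatorname*{Lim\,sup}_{\substack{x\to\bar x\\ f(x)>f(\bar x)}}\partial f(x).$$
   Context: $\mathbb{R}^n$ carries the standard scalar product $\langle\cdot,\cdot\rangle$ and Euclidean norm $\|\cdot\|$; $\mathcal{S}$ is the unit sphere. A function $g:X\to\mathbb{R}$ is Hadamard directionally differentiable at $x\in X$ if for every $p\in\mathbb{R}^n$ the limit $g'(x;p)=\lim_{t\downarrow 0,\ p'\to p}\frac{g(x+tp')-g(x)}{t}$ exists and is finite; $g'(x;p)$ is the (Hadamard) directional derivative. Sublinear means convex and positively homogeneous of degree one. (Under the hypotheses, $f$ is also Hadamard directionally differentiable at $\bar x$, so $f'(\bar x;p)$ is defined.) The Fréchet subdifferential of $g:X\to\mathbb{R}$ at $x\in X$ is $$\partial g(x)=\Big\{v\in\mathbb{R}^n\ \Big|\ \liminf_{z\to x,\ z\neq x}\frac{g(z)-g(x)-\langle v,z-x\rangle}{\|z-x\|}\ge 0\Big\}.$$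 Active index sets: $I(x)=\{i\in I\mid f_i(x)=f(x)\}$ and $$I(\bar x,p)=\Big\{i_0\in I(\bar x)\ \Big|\ \max_{v\in\partial f_{i_0}(\bar x)}\langle v,p\rangle=\min_{i\in I(\bar x)}\max_{v\in\partial f_i(\bar x)}\langle v,p\rangle\Big\}.$$ Outer limit: $\operatorname{Lim\,sup}_{x\to\bar x,\ f(x)>f(\bar x)}\partial f(x)$ is the set of all $y\in\mathbb{R}^n$ for which there exist sequences $x_k\to\bar x$ in $X$ with $f(x_k)>f(\bar x)$ and $y_k\in\partial f(x_k)$ with $y_k\to y$. *)

theory Defs
  imports "HOL-Analysis.Analysis"
begin

text \<open>Functions \<open>g : X \<rightarrow> \<real>\<close> are total HOL functions of which only the values on \<open>X\<close> matter;
  every limit below is therefore taken relative to \<open>X\<close>.\<close>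

definition hadamard_filter ::
  "'a::euclidean_space set \<Rightarrow> 'a \<Rightarrow> 'a \<Rightarrow> (real \<times> 'a) filter" where
  "hadamard_filter X x p =
     inf (at_right 0 \<times>\<^sub>F nhds p) (principal {(t, q). x + t *\<^sub>R q \<in> X})"

definition hadamard_quotient ::
  "('a::euclidean_space \<Rightarrow> real) \<Rightarrow> 'a \<Rightarrow> real \<times> 'a \<Rightarrow> real" where
  "hadamard_quotient g x = (\<lambda>(t, q). (g (x + t *\<^sub>R q) - g x) / t)"

definition hadamard_dir_differentiable ::
  "'a::euclidean_space set \<Rightarrow> ('a \<Rightarrow> real) \<Rightarrow> 'a \<Rightarrow> bool" where
  "hadamard_dir_differentiable X g x \<longleftrightarrow>
     (\<forall>p. \<exists>l. (hadamard_quotient g x \<longlongrightarrow> l) (hadamard_filter X x p))"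

definition hadamard_dir_deriv ::
  "'a::euclidean_space set \<Rightarrow> ('a \<Rightarrow> real) \<Rightarrow> 'a \<Rightarrow> 'a \<Rightarrow> real" where
  "hadamard_dir_deriv X g x p = Lim (hadamard_filter X x p) (hadamard_quotient g x)"

definition sublinear :: "('a::euclidean_space \<Rightarrow> real) \<Rightarrow> bool" where
  "sublinear h \<longleftrightarrow> convex_on UNIV h \<and> (\<forall>c>0. \<forall>p. h (c *\<^sub>R p) = c * h p)"

definition frechet_subdiff ::
  "'a::euclidean_space set \<Rightarrow> ('a \<Rightarrow> real) \<Rightarrow> 'a \<Rightarrow> 'a set" where
  "frechet_subdiff X g x =
     {v. Liminf (at x within X) (\<lambda>z. ereal ((g z - g x - v \<bullet> (z - x)) / norm (z - x))) \<ge> 0}"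

definition active_indices ::
  "'i set \<Rightarrow> ('i \<Rightarrow> 'a \<Rightarrow> real) \<Rightarrow> ('a \<Rightarrow> real) \<Rightarrow> 'a \<Rightarrow> 'i set" where
  "active_indices I fs f x = {i \<in> I. fs i x = f x}"

text \<open>\<open>max_inner A p\<close> is the maximum of \<open>\<langle>v, p\<rangle>\<close> over \<open>v \<in> A\<close>; it is unspecified when the maximum is
  not attained. \<open>Max\<close> cannot be used because \<open>A\<close> is in general infinite.\<close>

definition max_inner :: "'a::euclidean_space set \<Rightarrow> 'a \<Rightarrow> real" where
  "max_inner A p = (GREATEST m. m \<in> (\<lambda>v. v \<bullet> p) ` A)"

definition argmax_inner :: "'a::euclidean_space set \<Rightarrow> 'a \<Rightarrow> 'a set" where
  "argmax_inner A p = {v. is_arg_max (\<lambda>v. v \<bullet> p) (\<lambda>v. v \<in> A) v}"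

definition active_indices_dir ::
  "'a::euclidean_space set \<Rightarrow> 'i set \<Rightarrow> ('i \<Rightarrow> 'a \<Rightarrow> real) \<Rightarrow> ('a \<Rightarrow> real) \<Rightarrow> 'a \<Rightarrow> 'a \<Rightarrow> 'i set" where
  "active_indices_dir X I fs f x p =
     {i0 \<in> active_indices I fs f x.
        max_inner (frechet_subdiff X (fs i0) x) p =
        Min ((\<lambda>i. max_inner (frechet_subdiff X (fs i) x) p) ` active_indices I fs f x)}"

definition outer_limit ::
  "'a::euclidean_space set \<Rightarrow> 'a \<Rightarrow> ('a \<Rightarrow> 'a set) \<Rightarrow> 'a set" where
  "outer_limit S x F =
     {y. \<exists>xs ys. (\<forall>k::nat. xs k \<in> S \<and> ys k \<in> F (xs k)) \<and>
            xs \<longlonglongrightarrow> x \<and> ys \<longlonglongrightarrow> y}"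

end

theory Submission
  imports Defs
begin

text \<open>
  Write \<open>h\<^sub>i = f\<^sub>i'(xbar; \<cdot>)\<close>. Then \<open>f'(xbar; \<cdot>)\<close> is the minimum \<open>h\<close> of the active \<open>h\<^sub>i\<close>, and
  \<open>h\<^sub>i\<close> is the support function of the Frechet subdifferential of \<open>f\<^sub>i\<close> at \<open>xbar\<close>. If \<open>v\<close> lies in
  the intersection belonging to the direction \<open>p\<close>, then \<open>v \<bullet> q \<le> h q\<close> for \<open>q\<close> near \<open>p\<close>, with
  equality at \<open>p\<close>. For \<open>t\<^sub>k \<down> 0\<close> let \<open>q\<^sub>k\<close> minimise
  \<open>(f (xbar + t\<^sub>k q) - f xbar) / t\<^sub>k - v \<bullet> q + \<parallel>q - p\<parallel>\<^sup>2\<close> over a small closed ball around \<open>p\<close>. By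
  Hadamard differentiability every limit point of \<open>q\<^sub>k\<close> minimises \<open>h q - v \<bullet> q + \<parallel>q - p\<parallel>\<^sup>2\<close>, so
  it is \<open>p\<close>. Hence \<open>q\<^sub>k\<close> is eventually interior to the ball, \<open>v - 2 (q\<^sub>k - p)\<close> is a subgradient of
  \<open>f\<close> at \<open>xbar + t\<^sub>k q\<^sub>k\<close>, and it converges to \<open>v\<close> along a subsequence.
\<close>

section \<open>Hadamard difference quotients and their limits\<close>

lemma hadamard_filter_eq:
  assumes "open X" and "x \<in> X"
  shows "hadamard_filter X x p = at_right 0 \<times>\<^sub>F nhds p"
proof -
  \<comment> \<open>Points \<open>x + t q\<close> converge to \<open>x\<close>, so for open
    \<open>X\<close> the constraint in the filter holds eventually and intersecting with it changes
    nothing.\<close>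
  have "((\<lambda>u. x + fst u *\<^sub>R snd u) \<longlongrightarrow> x + 0 *\<^sub>R p) (at_right 0 \<times>\<^sub>F nhds p)"
    by (intro tendsto_intros filterlim_snd filterlim_compose[OF tendsto_ident_at filterlim_fst])
  then have "((\<lambda>u. x + fst u *\<^sub>R snd u) \<longlongrightarrow> x) (at_right 0 \<times>\<^sub>F nhds p)"
    by simp
  then have "\<forall>\<^sub>F u in at_right 0 \<times>\<^sub>F nhds p. x + fst u *\<^sub>R snd u \<in> X"
    using assms by (rule topological_tendstoD)
  then have "at_right 0 \<times>\<^sub>F nhds p \<le> principal {(t, q). x + t *\<^sub>R q \<in> X}"
    by (simp add: le_principal case_prod_beta)
  then show ?thesis
    by (simp add: hadamard_filter_def inf_absorb1)
qed

text \<open>Limits are unique here because the filter is a product of two nontrivial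
  filters.\<close>

lemma hadamard_dir_deriv_eqI:
  assumes "open X" and "x \<in> X"
    and "(hadamard_quotient g x \<longlongrightarrow> l) (hadamard_filter X x p)"
  shows "hadamard_dir_deriv X g x p = l"
  unfolding hadamard_dir_deriv_def
  using assms by (intro tendsto_Lim) (simp_all add: hadamard_filter_eq prod_filter_eq_bot)

lemma hadamard_dir_differentiableD:
  assumes "open X" and "x \<in> X" and "hadamard_dir_differentiable X g x"
  shows "(hadamard_quotient g x \<longlongrightarrow> hadamard_dir_deriv X g x p) (hadamard_filter X x p)"
  using assms hadamard_dir_deriv_eqI unfolding hadamard_dir_differentiable_def by metis

lemma hadamard_quotient_sequentially:
  assumes "open X" and "x \<in> X"
    and "(hadamard_quotient g x \<longlongrightarrow> l) (hadamard_filter X x p)"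
    and "t \<longlonglongrightarrow> 0" and "\<And>k. t k > 0" and "q \<longlonglongrightarrow> p"
  shows "(\<lambda>k. (g (x + t k *\<^sub>R q k) - g x) / t k) \<longlonglongrightarrow> l"
proof -
  have "filterlim t (at_right 0) sequentially"
    using assms(4) less_imp_neq[OF assms(5), symmetric] assms(5) by (simp add: filterlim_at)
  then have "filterlim (\<lambda>k. (t k, q k)) (hadamard_filter X x p) sequentially"
    unfolding hadamard_filter_eq[OF assms(1,2)] using assms(6) by (rule filterlim_Pair)
  from filterlim_compose[OF assms(3) this] show ?thesis
    by (simp add: hadamard_quotient_def)
qed

lemma eventually_hadamard_filter:
  assumes "open X" and "x \<in> X"
  shows "\<forall>\<^sub>F u in hadamard_filter X x p. x + fst u *\<^sub>R snd u \<in> X \<and> fst u > 0"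
proof (rule eventually_conj)
  show "\<forall>\<^sub>F u in hadamard_filter X x p. x + fst u *\<^sub>R snd u \<in> X"
    by (simp add: hadamard_filter_def eventually_inf_principal case_prod_beta)
  show "\<forall>\<^sub>F u in hadamard_filter X x p. fst u > 0"
    unfolding hadamard_filter_eq[OF assms]
    using filterlim_fst eventually_at_right_less by (rule eventually_compose_filterlim[rotated])
qed

lemma eventually_less_of_tendsto:
  fixes a b :: "'b \<Rightarrow> real"
  assumes "l < m" and "(a \<longlongrightarrow> l) F" and "(b \<longlongrightarrow> m) F"
  shows "\<forall>\<^sub>F u in F. a u < b u"
proof -
  obtain c where "l < c" "c < m"
    using assms(1) dense by blast
  with assms(2,3) have "\<forall>\<^sub>F u in F. a u < c" "\<forall>\<^sub>F u in F. c < b u"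
    by (auto dest: order_tendstoD)
  then show ?thesis
    by eventually_elim simp
qed

text \<open>The increment is \<open>t\<close> times a convergent quotient, so it vanishes. This
  serves as a substitute for continuity of the individual pieces \<open>fs i\<close>.\<close>

lemma hadamard_imp_tendsto:
  assumes "open X" and "x \<in> X"
    and "(hadamard_quotient g x \<longlongrightarrow> l) (hadamard_filter X x p)"
  shows "((\<lambda>u. g (x + fst u *\<^sub>R snd u)) \<longlongrightarrow> g x) (hadamard_filter X x p)"
proof -
  let ?F = "hadamard_filter X x p"
  have fst: "(fst \<longlongrightarrow> 0) ?F" and pos: "\<forall>\<^sub>F u in ?F. fst u > 0"
    unfolding hadamard_filter_eq[OF assms(1,2)]
    using filterlim_fst[of "at_right 0" "nhds p"] eventually_at_right_less[of "0::real"]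
    by (auto simp: filterlim_at elim: eventually_mono)
  have "((\<lambda>u. g x + fst u * hadamard_quotient g x u) \<longlongrightarrow> g x + 0 * l) ?F"
    by (intro tendsto_intros fst assms(3))
  moreover have "\<forall>\<^sub>F u in ?F. g x + fst u * hadamard_quotient g x u = g (x + fst u *\<^sub>R snd u)"
    using pos by eventually_elim (auto simp: hadamard_quotient_def case_prod_beta)
  ultimately show ?thesis
    by (simp add: tendsto_cong)
qed

section \<open>Directional derivative of a finite minimum\<close>

lemma tendsto_Min_image:
  fixes g :: "'i \<Rightarrow> 'b \<Rightarrow> real"
  assumes "finite A" and "A \<noteq> {}" and "\<And>i. i \<in> A \<Longrightarrow> (g i \<longlongrightarrow> l i) F"
  shows "((\<lambda>u. Min ((\<lambda>i. g i u) ` A)) \<longlongrightarrow> Min (l ` A)) F"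
  using assms
proof (induction A rule: finite_ne_induct)
  case (insert i A)
  then show ?case by (auto intro!: tendsto_min)
qed auto

text \<open>Close to \<open>x\<close> every inactive piece stays strictly above a fixed active one,
  so only active pieces compete. These share the value \<open>f x\<close>, hence the quotient of
  \<open>f\<close> is the minimum of their quotients.\<close>

lemma hadamard_quotient_Min:
  assumes X: "open X" "x \<in> X" and I: "finite I" "I \<noteq> {}"
    and f: "\<And>z. z \<in> X \<Longrightarrow> f z = Min ((\<lambda>i. fs i z) ` I)"
    and d: "\<And>i. i \<in> I \<Longrightarrow> (hadamard_quotient (fs i) x \<longlongrightarrow> h i) (hadamard_filter X x p)"
  shows "(hadamard_quotient f x \<longlongrightarrow> Min (h ` active_indices I fs f x)) (hadamard_filter X x p)"
proof -
  let ?F = "hadamard_filter X x p" and ?A = "active_indices I fs f x"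
  have A: "finite ?A" "?A \<subseteq> I"
    using I by (auto simp: active_indices_def)
  have "f x \<in> (\<lambda>i. fs i x) ` I"
    using f[OF X(2)] I by (metis Min_in finite_imageI image_is_empty)
  then obtain j where j: "j \<in> ?A"
    by (auto simp: active_indices_def)
  then have "j \<in> I" "fs j x = f x"
    by (auto simp: active_indices_def)
  have lt: "\<forall>\<^sub>F u in ?F. fs j (x + fst u *\<^sub>R snd u) < fs i (x + fst u *\<^sub>R snd u)" if "i \<in> I - ?A" for i
  proof -
    have "f x \<le> fs i x"
      using that f[OF X(2)] I by simp
    with that have "fs j x < fs i x"
      using \<open>fs j x = f x\<close> by (auto simp: active_indices_def)
    moreover have "((\<lambda>u. fs k (x + fst u *\<^sub>R snd u)) \<longlongrightarrow> fs k x) ?F" if "k \<in> I" for k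
      using hadamard_imp_tendsto[OF X d[OF that]] .
    ultimately show ?thesis
      using that \<open>j \<in> I\<close> by (intro eventually_less_of_tendsto) auto
  qed
  have lt': "\<forall>\<^sub>F u in ?F. \<forall>i\<in>I - ?A. fs j (x + fst u *\<^sub>R snd u) < fs i (x + fst u *\<^sub>R snd u)"
    using I lt by (intro eventually_ball_finite) auto
  have inX: "\<forall>\<^sub>F u in ?F. x + fst u *\<^sub>R snd u \<in> X \<and> fst u > 0"
    using eventually_hadamard_filter[OF X] .
  have "\<forall>\<^sub>F u in ?F. Min ((\<lambda>i. hadamard_quotient (fs i) x u) ` ?A) = hadamard_quotient f x u"
    using lt' inX
  proof eventually_elim
    case (elim u)
    let ?z = "x + fst u *\<^sub>R snd u"
    have q: "hadamard_quotient (fs i) x u = (fs i ?z - f x) / fst u" if "i \<in> ?A" for i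
      using that by (simp add: hadamard_quotient_def case_prod_beta active_indices_def)
    have "f ?z \<in> (\<lambda>i. fs i ?z) ` I"
      using f[of ?z] elim I by (metis Min_in finite_imageI image_is_empty)
    then obtain m where m: "m \<in> I" "f ?z = fs m ?z"
      by auto
    have le: "f ?z \<le> fs i ?z" if "i \<in> I" for i
      using f[of ?z] elim I that by simp
    \<comment> \<open>Were the minimising index \<open>m\<close> inactive, \<open>fs j\<close> would
      lie strictly below the minimum at \<open>?z\<close>.\<close>
    have "m \<in> ?A"
      using elim m le[OF \<open>j \<in> I\<close>] by (metis DiffI not_less)
    show ?case
    proof (rule Min_eqI)
      show "hadamard_quotient f x u \<in> (\<lambda>i. hadamard_quotient (fs i) x u) ` ?A"
        using q[OF \<open>m \<in> ?A\<close>] \<open>m \<in> ?A\<close> unfolding m(2)[symmetric]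
        by (intro image_eqI[of _ _ m]) (simp_all add: hadamard_quotient_def[of f] case_prod_beta)
      fix y assume "y \<in> (\<lambda>i. hadamard_quotient (fs i) x u) ` ?A"
      then obtain i where i: "i \<in> ?A" "y = (fs i ?z - f x) / fst u"
        using q by auto
      then show "hadamard_quotient f x u \<le> y"
        using le[of i] A elim
        by (auto simp: hadamard_quotient_def case_prod_beta intro!: divide_right_mono)
    qed (use A in auto)
  qed
  moreover have "((\<lambda>u. Min ((\<lambda>i. hadamard_quotient (fs i) x u) ` ?A)) \<longlongrightarrow> Min (h ` ?A)) ?F"
    using A j d by (intro tendsto_Min_image) auto
  ultimately show ?thesis
    using tendsto_cong by fast
qed

section \<open>The Frechet subdifferential as the set of linear minorants of the derivative\<close>

lemma frechet_subdiff_iff: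
  "v \<in> frechet_subdiff X g x \<longleftrightarrow>
    (\<forall>e>0. \<forall>\<^sub>F z in at x within X. g z - g x - v \<bullet> (z - x) \<ge> - e * norm (z - x))"
  (is "_ = ?R")
proof -
  have "v \<in> frechet_subdiff X g x \<longleftrightarrow>
    (\<forall>e>0. \<forall>\<^sub>F z in at x within X. (g z - g x - v \<bullet> (z - x)) / norm (z - x) > - e)"
    (is "_ = ?M")
  proof
    assume "v \<in> frechet_subdiff X g x"
    then have *: "\<forall>y<0. \<forall>\<^sub>F z in at x within X. y < ereal ((g z - g x - v \<bullet> (z - x)) / norm (z - x))"
      by (simp add: frechet_subdiff_def le_Liminf_iff)
    show ?M
      using *[rule_format, of "ereal (- e)" for e] by simp
  next
    assume M: ?M
    have "\<forall>\<^sub>F z in at x within X. y < ereal ((g z - g x - v \<bullet> (z - x)) / norm (z - x))"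
      if "y < 0" for y :: ereal
    proof -
      \<comment> \<open>A real number between \<open>y\<close> and 0 also covers the case where
        \<open>y\<close> is minus infinity; \<open>- r\<close> then plays the role of
        \<open>e\<close>.\<close>
      obtain r where r: "y < ereal r" "ereal r < 0"
        using ereal_dense2[OF \<open>y < 0\<close>] by blast
      then have "\<forall>\<^sub>F z in at x within X. (g z - g x - v \<bullet> (z - x)) / norm (z - x) > - (- r)"
        using M by (intro M[rule_format]) simp
      then show ?thesis
        by eventually_elim (use r(1) in \<open>auto intro: less_trans\<close>)
    qed
    then show "v \<in> frechet_subdiff X g x"
      by (simp add: frechet_subdiff_def le_Liminf_iff)
  qed
  also have "\<dots> \<longleftrightarrow> ?R"
  proof (intro iffI allI impI)
    fix e :: real assume M: ?M and "e > 0"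
    have "\<forall>\<^sub>F z in at x within X. z \<noteq> x"
      by (simp add: eventually_at_filter)
    with M[rule_format, OF \<open>e > 0\<close>]
    show "\<forall>\<^sub>F z in at x within X. g z - g x - v \<bullet> (z - x) \<ge> - e * norm (z - x)"
      by eventually_elim (simp add: field_simps)
  next
    fix e :: real assume R: ?R and "e > 0"
    have "\<forall>\<^sub>F z in at x within X. z \<noteq> x"
      by (simp add: eventually_at_filter)
    \<comment> \<open>Halving \<open>e\<close> turns the weak bound into the strict one after
      division by the positive norm.\<close>
    with R[rule_format, of "e/2"] \<open>e > 0\<close>
    have "\<forall>\<^sub>F z in at x within X. z \<noteq> x \<and> g z - g x - v \<bullet> (z - x) \<ge> - (e/2) * norm (z - x)"
      by (auto elim: eventually_elim2)
    then show "\<forall>\<^sub>F z in at x within X. (g z - g x - v \<bullet> (z - x)) / norm (z - x) > - e"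
    proof eventually_elim
      case (elim z)
      then have "- e * norm (z - x) < - (e/2) * norm (z - x)"
        using \<open>e > 0\<close> by simp
      with elim show ?case
        by (simp add: pos_less_divide_eq)
    qed
  qed
  finally show ?thesis .
qed

text \<open>Testing the subgradient inequality along rays bounds \<open>v \<bullet> q\<close> by the
  derivative. Conversely, points violating it have unit directions that accumulate on the compact
  sphere; Hadamard convergence allows these moving directions, and in the limit direction the
  derivative falls short of \<open>v\<close> by at least \<open>e\<close>.\<close>

lemma frechet_subdiff_eq_hadamard:
  fixes g :: "'a::euclidean_space \<Rightarrow> real"
  assumes X: "open X" "x \<in> X" and d: "hadamard_dir_differentiable X g x"
  shows "frechet_subdiff X g x = {v. \<forall>q. v \<bullet> q \<le> hadamard_dir_deriv X g x q}"
proof (intro equalityI subsetI CollectI allI)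
  fix v q assume v: "v \<in> frechet_subdiff X g x"
  let ?h = "hadamard_dir_deriv X g x"
  have "v \<bullet> q \<le> ?h q + e * norm q" if "e > 0" for e
  proof -
    define t where "t k = inverse (real (Suc k))" for k
    have t: "t \<longlonglongrightarrow> 0" "\<And>k. t k > 0"
      unfolding t_def by (rule LIMSEQ_inverse_real_of_nat) simp
    have lim: "(\<lambda>k. (g (x + t k *\<^sub>R q) - g x) / t k) \<longlonglongrightarrow> ?h q"
      by (rule hadamard_quotient_sequentially[OF X hadamard_dir_differentiableD[OF X d] t]) simp
    have "(\<lambda>k. x + t k *\<^sub>R q) \<longlonglongrightarrow> x + 0 *\<^sub>R q"
      by (intro tendsto_intros t)
    then have to_x: "(\<lambda>k. x + t k *\<^sub>R q) \<longlonglongrightarrow> x" by simp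
    have "\<forall>\<^sub>F z in nhds x. z \<noteq> x \<longrightarrow> z \<in> X \<longrightarrow> g z - g x - v \<bullet> (z - x) \<ge> - e * norm (z - x)"
      using v that by (simp add: frechet_subdiff_iff eventually_at_filter)
    moreover have "\<forall>\<^sub>F z in nhds x. z \<in> X"
      using X by (rule eventually_nhds_in_open)
    ultimately have "\<forall>\<^sub>F z in nhds x. g z - g x - v \<bullet> (z - x) \<ge> - e * norm (z - x)"
      by eventually_elim auto
    from eventually_compose_filterlim[OF this to_x]
    have "\<forall>\<^sub>F k in sequentially. v \<bullet> q - e * norm q \<le> (g (x + t k *\<^sub>R q) - g x) / t k"
    proof eventually_elim
      case (elim k)
      then show ?case using t(2)[of k] by (simp add: field_simps)
    qed
    then have "v \<bullet> q - e * norm q \<le> ?h q"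
      using tendsto_lowerbound[OF lim] by simp
    then show ?thesis by simp
  qed
  note bound = this
  show "v \<bullet> q \<le> ?h q"
  proof (rule field_le_epsilon)
    fix e :: real assume "e > 0"
    \<comment> \<open>The added 1 keeps the denominator positive when \<open>q\<close> is
      zero.\<close>
    have "v \<bullet> q \<le> ?h q + e / (norm q + 1) * norm q"
      using \<open>e > 0\<close> by (intro bound divide_pos_pos add_nonneg_pos) auto
    also have "e / (norm q + 1) * norm q \<le> e"
      using \<open>e > 0\<close> add_nonneg_pos[OF norm_ge_zero[of q] zero_less_one]
      by (simp add: field_simps)
    finally show "v \<bullet> q \<le> ?h q + e" by simp
  qed
next
  fix v assume v: "v \<in> {v. \<forall>q. v \<bullet> q \<le> hadamard_dir_deriv X g x q}"
  show "v \<in> frechet_subdiff X g x"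
    unfolding frechet_subdiff_iff
  proof (intro allI impI, rule ccontr)
    fix e :: real assume "e > 0"
    let ?P = "\<lambda>z. g z - g x - v \<bullet> (z - x) \<ge> - e * norm (z - x)"
    assume neg: "\<not> (\<forall>\<^sub>F z in at x within X. ?P z)"
    have "\<exists>z. dist z x < inverse (real (Suc k)) \<and> z \<noteq> x \<and> \<not> ?P z" for k
    proof -
      have "inverse (real (Suc k)) > 0" by simp
      with neg show ?thesis
        unfolding eventually_at by blast
    qed
    then obtain z where z: "\<And>k. dist (z k) x < inverse (real (Suc k))"
      "\<And>k. z k \<noteq> x" "\<And>k. \<not> ?P (z k)"
      by metis
    \<comment> \<open>Polar coordinates around \<open>x\<close>: \<open>z k = x + t k q k\<close>
      with \<open>q k\<close> of norm one, so dividing the violated inequality by \<open>t k\<close>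
      leaves exactly the gap \<open>e\<close>.\<close>
    define t where "t k = norm (z k - x)" for k
    define q where "q k = (z k - x) /\<^sub>R t k" for k
    have t0: "t k > 0" for k
      using z(2) by (simp add: t_def)
    have t: "t \<longlonglongrightarrow> 0"
      unfolding t_def using z(1)
      by (intro tendsto_sandwich[OF _ _ tendsto_const LIMSEQ_inverse_real_of_nat])
         (auto simp: dist_norm intro!: always_eventually less_imp_le)
    have q1: "q k \<in> sphere 0 1" for k
      using t0[of k] by (simp add: q_def t_def)
    obtain p \<sigma> where p: "strict_mono \<sigma>" "(q \<circ> \<sigma>) \<longlonglongrightarrow> p"
      using compact_sphere[of 0 1] q1 unfolding compact_def by metis
    have "(\<lambda>k. (g (x + t (\<sigma> k) *\<^sub>R q (\<sigma> k)) - g x) / t (\<sigma> k)) \<longlonglongrightarrow> hadamard_dir_deriv X g x p"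
      using hadamard_quotient_sequentially[OF X hadamard_dir_differentiableD[OF X d], of "t \<circ> \<sigma>" "q \<circ> \<sigma>" p]
        LIMSEQ_subseq_LIMSEQ[OF t p(1)] t0 p(2) by simp
    moreover have "(\<lambda>k. v \<bullet> q (\<sigma> k) - e) \<longlonglongrightarrow> v \<bullet> p - e"
      using p(2) by (intro tendsto_intros) (simp add: comp_def)
    moreover have "(g (x + t k *\<^sub>R q k) - g x) / t k \<le> v \<bullet> q k - e" for k
    proof -
      have "x + t k *\<^sub>R q k = z k" "v \<bullet> (z k - x) = t k * (v \<bullet> q k)"
        using t0[of k] by (auto simp: q_def)
      with z(3)[of k] t0[of k] show ?thesis
        by (simp add: t_def[symmetric] field_simps)
    qed
    ultimately have "hadamard_dir_deriv X g x p \<le> v \<bullet> p - e"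
      by (intro LIMSEQ_le) auto
    moreover have "v \<bullet> p \<le> hadamard_dir_deriv X g x p"
      using v by simp
    ultimately show False
      using \<open>e > 0\<close> by simp
  qed
qed

section \<open>Sublinear derivatives as support functions\<close>

lemma sublinear_subgradient_exists:
  fixes h :: "'a::euclidean_space \<Rightarrow> real"
  assumes "sublinear h"
  obtains v where "\<And>q. v \<bullet> q \<le> h q" and "v \<bullet> p = h p"
proof -
  have cvx: "convex_on UNIV h" and hom: "\<And>c q. c > 0 \<Longrightarrow> h (c *\<^sub>R q) = c * h q"
    using assms by (auto simp: sublinear_def)
  \<comment> \<open>Separate \<open>(p, h p)\<close> from the strict epigraph: the separating hyperplane is not vertical since \<open>h\<close>
    is finite everywhere, so its slope is a subgradient at \<open>p\<close>.\<close>
  define T where "T = {(q, s). h q < s}"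
  have "convex T"
    unfolding convex_def
  proof (intro ballI allI impI)
    fix y z and a b :: real
    assume yz: "y \<in> T" "z \<in> T" and w: "a \<ge> 0" "b \<ge> 0" "a + b = 1"
    have "a * (h (fst y) - snd y) + b * (h (fst z) - snd z) < 0"
      using yz w by (intro convex_bound_lt) (auto simp: T_def)
    moreover have "h (a *\<^sub>R fst y + b *\<^sub>R fst z) \<le> a * h (fst y) + b * h (fst z)"
      using cvx w by (auto simp: convex_on_def)
    ultimately show "a *\<^sub>R y + b *\<^sub>R z \<in> T"
      by (simp add: T_def case_prod_beta algebra_simps)
  qed
  moreover have "(p, h p + 1) \<in> T" "{(p, h p)} \<inter> T = {}"
    by (auto simp: T_def)
  ultimately obtain A b where A: "A \<noteq> 0" "A \<bullet> (p, h p) \<le> b" "\<And>u. u \<in> T \<Longrightarrow> A \<bullet> u \<ge> b"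
    using separating_hyperplane_sets[of "{(p, h p)}" T]
    by (metis convex_singleton empty_iff insert_not_empty insertI1)
  obtain a \<alpha> where "A = (a, \<alpha>)" by fastforce
  with A have ne: "a \<noteq> 0 \<or> \<alpha> \<noteq> 0"
    and le: "\<And>q s. h q < s \<Longrightarrow> a \<bullet> p + \<alpha> * h p \<le> a \<bullet> q + \<alpha> * s"
    by (force simp: T_def zero_prod_def)+
  have "\<alpha> \<ge> 0"
    using le[of p "h p + 1"] by (simp add: algebra_simps)
  moreover have "\<alpha> \<noteq> 0"
  proof
    assume "\<alpha> = 0"
    then have "\<not> 0 < a \<bullet> a"
      using le[of "p - a" "h (p - a) + 1"] by (simp add: inner_diff_right del: inner_gt_zero_iff)
    with ne \<open>\<alpha> = 0\<close> show False
      by simp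
  qed
  ultimately have "\<alpha> > 0" by simp
  define v where "v = - a /\<^sub>R \<alpha>"
  have a: "a \<bullet> u = - (\<alpha> * (v \<bullet> u))" for u
    using \<open>\<alpha> > 0\<close> by (simp add: v_def)
  have le': "h p - v \<bullet> p \<le> h q - v \<bullet> q" for q
  proof (rule field_le_epsilon)
    fix e :: real assume "e > 0"
    then have "\<alpha> * (h p - v \<bullet> p) \<le> \<alpha> * (h q - v \<bullet> q + e)"
      using le[of q "h q + e"] by (simp add: a algebra_simps)
    with \<open>\<alpha> > 0\<close> show "h p - v \<bullet> p \<le> h q - v \<bullet> q + e"
      by simp
  qed
  \<comment> \<open>With \<open>m = h p - v \<bullet> p\<close>, minimality at \<open>p\<close> and
    homogeneity give \<open>m \<le> 2 m\<close> and \<open>m \<le> m / 2\<close>, which forces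
    \<open>m = 0\<close>.\<close>
  have "h p - v \<bullet> p = 0"
    using le'[of "2 *\<^sub>R p"] le'[of "(1/2) *\<^sub>R p"] hom[of 2 p] hom[of "1/2" p] by simp
  with le' show ?thesis
    by (intro that[of v]) (auto simp: algebra_simps)
qed

text \<open>The derivative bounds all the inner products from above, and a subgradient tight at
  \<open>p\<close> attains the bound, so \<open>GREATEST\<close> names an actual maximum.\<close>

lemma max_inner_frechet_subdiff:
  assumes "open X" "x \<in> X" "hadamard_dir_differentiable X g x"
    "sublinear (hadamard_dir_deriv X g x)"
  shows "max_inner (frechet_subdiff X g x) p = hadamard_dir_deriv X g x p"
proof -
  obtain v where "\<And>q. v \<bullet> q \<le> hadamard_dir_deriv X g x q" "v \<bullet> p = hadamard_dir_deriv X g x p"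
    using sublinear_subgradient_exists[OF assms(4)] by blast
  then show ?thesis
    unfolding max_inner_def frechet_subdiff_eq_hadamard[OF assms(1-3)]
    by (intro Greatest_equality) (auto simp: image_iff intro!: exI[of _ v])
qed

text \<open>Membership bounds \<open>v\<close> by the derivative, and a maximiser cannot do worse at
  \<open>p\<close> than a subgradient that is tight there.\<close>

lemma argmax_inner_frechet_subdiff:
  assumes "open X" "x \<in> X" "hadamard_dir_differentiable X g x"
    "sublinear (hadamard_dir_deriv X g x)"
    and v: "v \<in> argmax_inner (frechet_subdiff X g x) p"
  shows "v \<bullet> p = hadamard_dir_deriv X g x p" and "v \<bullet> q \<le> hadamard_dir_deriv X g x q"
proof -
  note eq = frechet_subdiff_eq_hadamard[OF assms(1-3)]
  obtain w where w: "\<And>q. w \<bullet> q \<le> hadamard_dir_deriv X g x q" "w \<bullet> p = hadamard_dir_deriv X g x p"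
    using sublinear_subgradient_exists[OF assms(4)] by blast
  have v1: "\<And>q. v \<bullet> q \<le> hadamard_dir_deriv X g x q" and "\<not> w \<bullet> p > v \<bullet> p"
    using v w(1) by (auto simp: argmax_inner_def is_arg_max_def eq)
  with w(2) show "v \<bullet> p = hadamard_dir_deriv X g x p" "v \<bullet> q \<le> hadamard_dir_deriv X g x q"
    by (auto intro: antisym)
qed

section \<open>Subgradients at interior penalised minimisers\<close>

lemma frechet_subdiff_of_penalised_minimiser:
  fixes f :: "'a::euclidean_space \<Rightarrow> real"
  assumes "t > 0" and q: "q \<in> ball p \<delta>"
    and min: "\<And>r. r \<in> cball p \<delta> \<Longrightarrow>
      (f (x + t *\<^sub>R q) - f x) / t - v \<bullet> q + (norm (q - p))\<^sup>2
      \<le> (f (x + t *\<^sub>R r) - f x) / t - v \<bullet> r + (norm (r - p))\<^sup>2"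
  shows "v - 2 *\<^sub>R (q - p) \<in> frechet_subdiff X f (x + t *\<^sub>R q)"
  unfolding frechet_subdiff_iff
proof (intro allI impI)
  fix e :: real assume "e > 0"
  define y where "y = x + t *\<^sub>R q"
  \<comment> \<open>With \<open>d = (z - y) / t\<close>, the first bound gives
    \<open>norm d < e\<close>, which controls the remainder; the second keeps \<open>q + d\<close>
    in the closed ball, where minimality applies.\<close>
  define \<eta> where "\<eta> = min (e * t) (t * (\<delta> - dist p q))"
  have "\<eta> > 0"
    using \<open>e > 0\<close> \<open>t > 0\<close> q by (simp add: \<eta>_def)
  have "\<forall>\<^sub>F z in at y within X. dist z y < \<eta>"
    using \<open>\<eta> > 0\<close> by (auto simp: eventually_at)
  then show "\<forall>\<^sub>F z in at (x + t *\<^sub>R q) within X.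
      - e * norm (z - (x + t *\<^sub>R q))
      \<le> f z - f (x + t *\<^sub>R q) - (v - 2 *\<^sub>R (q - p)) \<bullet> (z - (x + t *\<^sub>R q))"
    unfolding y_def[symmetric]
  proof eventually_elim
    case (elim z)
    define d where "d = (z - y) /\<^sub>R t"
    have z: "z = x + t *\<^sub>R (q + d)" and zy: "z - y = t *\<^sub>R d"
      using \<open>t > 0\<close> by (simp_all add: d_def y_def algebra_simps)
    have nd: "norm (z - y) = t * norm d"
      using \<open>t > 0\<close> by (simp add: zy)
    have "t * norm d < t * e" "t * norm d < t * (\<delta> - dist p q)"
      using elim nd by (auto simp: dist_norm \<eta>_def algebra_simps)
    then have d: "norm d < e" "norm d < \<delta> - dist p q"
      using \<open>t > 0\<close> by simp_all
    have "dist p (q + d) \<le> dist p q + norm d"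
      by (metis dist_triangle dist_norm add_diff_cancel_left' dist_commute)
    with d have "q + d \<in> cball p \<delta>"
      by simp
    from min[OF this] have "(f y - f x) / t - v \<bullet> q + (norm (q - p))\<^sup>2
      \<le> (f z - f x) / t - v \<bullet> (q + d) + (norm (q + d - p))\<^sup>2"
      by (simp add: z y_def)
    \<comment> \<open>The linear part of the penalty produces the shift \<open>2 (q - p)\<close> of
      \<open>v\<close>; the quadratic part is absorbed by the error
      \<open>e * norm (z - y)\<close>.\<close>
    moreover have "(norm (q + d - p))\<^sup>2 = (norm (q - p))\<^sup>2 + 2 * ((q - p) \<bullet> d) + (norm d)\<^sup>2"
      by (simp add: power2_norm_eq_inner algebra_simps inner_commute)
    moreover have "(f z - f x) / t - (f y - f x) / t = (f z - f y) / t"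
      by (simp add: diff_divide_distrib)
    ultimately have "(f z - f y) / t \<ge> v \<bullet> d - 2 * ((q - p) \<bullet> d) - (norm d)\<^sup>2"
      by (simp add: inner_add_right)
    then have "f z - f y \<ge> t * (v \<bullet> d - 2 * ((q - p) \<bullet> d) - (norm d)\<^sup>2)"
      using \<open>t > 0\<close> by (simp add: field_simps)
    moreover have "t * (norm d)\<^sup>2 \<le> t * (e * norm d)"
      using d(1) \<open>t > 0\<close> \<open>e > 0\<close> by (auto simp: power2_eq_square intro!: mult_mono)
    ultimately show ?case
      unfolding nd unfolding zy by (simp add: inner_diff_left algebra_simps)
  qed
qed

section \<open>Approximating subgradients at points of larger value\<close>

theorem theorem1:
  fixes X :: "(real ^ 'n) set" and xbar :: "real ^ 'n"
    and I :: "'i set" and fs :: "'i \<Rightarrow> real ^ 'n \<Rightarrow> real" and f :: "real ^ 'n \<Rightarrow> real"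
  assumes "open X" and "xbar \<in> X"
    and "finite I" and "I \<noteq> {}"
    and "continuous_on X f"
    and "\<And>x. x \<in> X \<Longrightarrow> f x = Min ((\<lambda>i. fs i x) ` I)"
    and "\<And>i. i \<in> I \<Longrightarrow> hadamard_dir_differentiable X (fs i) xbar"
    and "\<And>i. i \<in> I \<Longrightarrow> sublinear (hadamard_dir_deriv X (fs i) xbar)"
  shows "(\<Union>p \<in> {p \<in> sphere 0 1. hadamard_dir_deriv X f xbar p > 0}.
            \<Inter>i \<in> active_indices_dir X I fs f xbar p.
              argmax_inner (frechet_subdiff X (fs i) xbar) p)
         \<subseteq> outer_limit {x \<in> X. f x > f xbar} xbar (frechet_subdiff X f)"
proof (intro subsetI)
  let ?D = "hadamard_dir_deriv X" and ?A = "active_indices I fs f xbar"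
  note X = assms(1,2) and I = assms(3,4) and cont = assms(5) and f = assms(6)
  fix v assume "v \<in> (\<Union>p \<in> {p \<in> sphere 0 1. ?D f xbar p > 0}.
            \<Inter>i \<in> active_indices_dir X I fs f xbar p.
              argmax_inner (frechet_subdiff X (fs i) xbar) p)"
  then obtain p where p: "?D f xbar p > 0"
    and v: "\<And>i. i \<in> active_indices_dir X I fs f xbar p \<Longrightarrow>
              v \<in> argmax_inner (frechet_subdiff X (fs i) xbar) p"
    by auto
  define h where "h q = Min ((\<lambda>i. ?D (fs i) xbar q) ` ?A)" for q
  have A: "finite ?A" "\<And>i. i \<in> ?A \<Longrightarrow> i \<in> I"
    using I by (auto simp: active_indices_def)
  have "f xbar \<in> (\<lambda>i. fs i xbar) ` I"
    using f[OF X(2)] I by (metis Min_in finite_imageI image_is_empty)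
  then have A_ne: "?A \<noteq> {}"
    by (auto simp: active_indices_def)
  have lim_f: "(hadamard_quotient f xbar \<longlongrightarrow> h q) (hadamard_filter X xbar q)" for q
    unfolding h_def
    by (intro hadamard_quotient_Min[OF X I f] hadamard_dir_differentiableD[OF X] assms(7))
  then have h_p: "h p > 0"
    using p hadamard_dir_deriv_eqI[OF X] by metis
  have max: "max_inner (frechet_subdiff X (fs i) xbar) q = ?D (fs i) xbar q" if "i \<in> ?A" for i q
    using A(2)[OF that] by (intro max_inner_frechet_subdiff X assms(7,8))
  have Min_eq: "Min ((\<lambda>i. max_inner (frechet_subdiff X (fs i) xbar) p) ` ?A) = h p"
    unfolding h_def using max by (metis (mono_tags, lifting) image_cong)
  have Ap: "active_indices_dir X I fs f xbar p = {i \<in> ?A. ?D (fs i) xbar p = h p}"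
    unfolding active_indices_dir_def Min_eq using max by auto
  have v_le: "v \<bullet> q \<le> ?D (fs i) xbar q" and v_eq: "v \<bullet> p = h p"
    if "i \<in> ?A" "?D (fs i) xbar p = h p" for i q
    using that v[of i] argmax_inner_frechet_subdiff[OF X assms(7,8), of i v p] A(2) Ap by auto
  \<comment> \<open>Some active index attains the minimum, so the intersection is over a nonempty
    index set and really constrains \<open>v\<close>.\<close>
  have "h p \<in> (\<lambda>i. ?D (fs i) xbar p) ` ?A"
    unfolding h_def using A(1) A_ne by (intro Min_in) auto
  then have v_p: "v \<bullet> p = h p"
    using v_eq by auto

  \<comment> \<open>Indices attaining \<open>h p\<close> satisfy the bound for every
    \<open>q\<close>. For the others it is strict at \<open>p\<close> and persists nearby, since
    finite convex functions are continuous.\<close>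
  have "\<forall>\<^sub>F q in nhds p. \<forall>i\<in>?A. v \<bullet> q \<le> ?D (fs i) xbar q"
  proof (intro eventually_ball_finite ballI A(1))
    fix i assume i: "i \<in> ?A"
    show "\<forall>\<^sub>F q in nhds p. v \<bullet> q \<le> ?D (fs i) xbar q"
    proof (cases "?D (fs i) xbar p = h p")
      case True
      then show ?thesis using v_le i by simp
    next
      case False
      moreover have "h p \<le> ?D (fs i) xbar p"
        unfolding h_def using A(1) i by (intro Min_le) auto
      ultimately have "v \<bullet> p < ?D (fs i) xbar p"
        using v_p by simp
      moreover have "continuous_on UNIV (?D (fs i) xbar)"
        using assms(8) A(2)[OF i] by (intro convex_on_continuous) (auto simp: sublinear_def)
      then have "(?D (fs i) xbar \<longlongrightarrow> ?D (fs i) xbar p) (nhds p)"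
        by (simp add: continuous_on_eq_continuous_at isCont_def tendsto_at_iff_tendsto_nhds)
      moreover have "((\<lambda>q. v \<bullet> q) \<longlongrightarrow> v \<bullet> p) (nhds p)"
        by (intro tendsto_intros filterlim_ident)
      ultimately have "\<forall>\<^sub>F q in nhds p. v \<bullet> q < ?D (fs i) xbar q"
        by (intro eventually_less_of_tendsto)
      then show ?thesis
        by eventually_elim simp
    qed
  qed
  then have "\<forall>\<^sub>F q in nhds p. v \<bullet> q \<le> h q"
    by eventually_elim (use A(1) A_ne in \<open>simp add: h_def\<close>)
  then obtain \<delta>0 where "\<delta>0 > 0" "\<And>q. dist q p < \<delta>0 \<Longrightarrow> v \<bullet> q \<le> h q"
    by (auto simp: eventually_nhds_metric)
  then obtain \<delta> where \<delta>: "\<delta> > 0" "\<And>q. q \<in> cball p \<delta> \<Longrightarrow> v \<bullet> q \<le> h q"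
    by (intro that[of "\<delta>0/2"]) (auto simp: dist_commute)

  obtain r where r: "r > 0" "ball xbar r \<subseteq> X"
    using X open_contains_ball by blast
  \<comment> \<open>Directions in the ball have norm at most \<open>norm p + \<delta>\<close> and
    step sizes are at most \<open>c\<close>, so all points tested stay within distance
    \<open>r\<close> of \<open>xbar\<close>. The added 1 makes this strict.\<close>
  define c where "c = r / (norm p + \<delta> + 1)"
  define t where "t k = c * inverse (real (Suc k))" for k
  have den: "norm p + \<delta> + 1 > 0"
    using \<delta>(1) by (intro add_nonneg_pos) auto
  have "c > 0"
    using r(1) den by (simp add: c_def)
  then have t0: "t k > 0" for k
    by (simp add: t_def)
  have "t \<longlonglongrightarrow> c * 0"
    unfolding t_def by (intro tendsto_intros LIMSEQ_inverse_real_of_nat)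
  then have t: "t \<longlonglongrightarrow> 0" by simp
  have inX: "xbar + t k *\<^sub>R q \<in> X" if "q \<in> cball p \<delta>" for k q
  proof -
    have "norm q \<le> norm p + \<delta>"
      using that norm_triangle_ineq2[of q p] by (simp add: dist_norm norm_minus_commute)
    moreover have "t k \<le> c"
      using \<open>c > 0\<close> by (simp add: t_def field_simps)
    ultimately have "t k * norm q \<le> c * (norm p + \<delta>)"
      using \<open>c > 0\<close> by (intro mult_mono) auto
    also have "\<dots> < r"
      using r(1) den by (simp add: c_def field_simps)
    finally show ?thesis
      using r(2) t0[of k] by (auto simp: dist_norm)
  qed

  define \<phi> where "\<phi> k q = (f (xbar + t k *\<^sub>R q) - f xbar) / t k - v \<bullet> q + (norm (q - p))\<^sup>2" for k q
  have "\<exists>q\<in>cball p \<delta>. \<forall>q'\<in>cball p \<delta>. \<phi> k q \<le> \<phi> k q'" for k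
  proof (rule continuous_attains_inf)
    have "continuous_on (cball p \<delta>) (\<lambda>q. f (xbar + t k *\<^sub>R q))"
      by (rule continuous_on_compose2[OF cont]) (auto intro!: continuous_intros inX)
    then show "continuous_on (cball p \<delta>) (\<phi> k)"
      unfolding \<phi>_def using t0[of k] by (intro continuous_intros) auto
  qed (use \<delta>(1) in auto)
  then obtain q where q: "\<And>k. q k \<in> cball p \<delta>"
    "\<And>k q'. q' \<in> cball p \<delta> \<Longrightarrow> \<phi> k (q k) \<le> \<phi> k q'"
    by metis
  obtain q0 \<sigma> where q0: "q0 \<in> cball p \<delta>" "strict_mono \<sigma>" "(q \<circ> \<sigma>) \<longlonglongrightarrow> q0"
    using compact_cball[of p \<delta>] q(1) unfolding compact_def by metis
  have t\<sigma>: "(\<lambda>k. t (\<sigma> k)) \<longlonglongrightarrow> 0" and q\<sigma>: "(\<lambda>k. q (\<sigma> k)) \<longlonglongrightarrow> q0"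
    using LIMSEQ_subseq_LIMSEQ[OF t q0(2)] q0(3) by (simp_all add: comp_def)
  have quot: "(\<lambda>k. (f (xbar + t (\<sigma> k) *\<^sub>R q (\<sigma> k)) - f xbar) / t (\<sigma> k)) \<longlonglongrightarrow> h q0"
    by (rule hadamard_quotient_sequentially[OF X lim_f t\<sigma> t0 q\<sigma>])
  \<comment> \<open>The constant direction \<open>p\<close> is the competitor. In the limit,
    \<open>v \<bullet> q0 \<le> h q0\<close> and \<open>v \<bullet> p = h p\<close> leave only the
    penalty, which must vanish.\<close>
  have "(\<lambda>k. \<phi> (\<sigma> k) p) \<longlonglongrightarrow> h p - v \<bullet> p + (norm (p - p))\<^sup>2"
    unfolding \<phi>_def
    by (intro tendsto_intros hadamard_quotient_sequentially[OF X lim_f t\<sigma> t0 tendsto_const])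
  moreover have "(\<lambda>k. \<phi> (\<sigma> k) (q (\<sigma> k))) \<longlonglongrightarrow> h q0 - v \<bullet> q0 + (norm (q0 - p))\<^sup>2"
    unfolding \<phi>_def by (intro tendsto_intros quot q\<sigma>)
  moreover have "\<phi> (\<sigma> k) (q (\<sigma> k)) \<le> \<phi> (\<sigma> k) p" for k
    using \<delta>(1) by (intro q(2)) simp
  ultimately have "h q0 - v \<bullet> q0 + (norm (q0 - p))\<^sup>2 \<le> h p - v \<bullet> p + (norm (p - p))\<^sup>2"
    by (intro LIMSEQ_le) auto
  then have "(norm (q0 - p))\<^sup>2 \<le> 0"
    using \<delta>(2)[OF q0(1)] v_p unfolding diff_self norm_zero zero_power2 by linarith
  then have "q0 = p"
    by simp

  \<comment> \<open>Here positivity of the derivative at \<open>p\<close> enters: the quotients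
    converge to \<open>h p\<close>, so the values of \<open>f\<close> eventually exceed
    \<open>f xbar\<close>.\<close>
  have "\<forall>\<^sub>F k in sequentially. (f (xbar + t (\<sigma> k) *\<^sub>R q (\<sigma> k)) - f xbar) / t (\<sigma> k) > 0"
    using order_tendstoD(1)[OF quot] h_p \<open>q0 = p\<close> by simp
  moreover have "\<forall>\<^sub>F k in sequentially. q (\<sigma> k) \<in> ball p \<delta>"
    using topological_tendstoD[OF q\<sigma>, of "ball p \<delta>"] \<delta>(1) \<open>q0 = p\<close> by simp
  ultimately have "\<forall>\<^sub>F k in sequentially. f (xbar + t (\<sigma> k) *\<^sub>R q (\<sigma> k)) > f xbar \<and> q (\<sigma> k) \<in> ball p \<delta>"
    by eventually_elim (use t0 in \<open>auto simp: zero_less_divide_iff dest: less_asym\<close>)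
  then obtain N where N: "\<And>k. k \<ge> N \<Longrightarrow> f (xbar + t (\<sigma> k) *\<^sub>R q (\<sigma> k)) > f xbar \<and> q (\<sigma> k) \<in> ball p \<delta>"
    by (auto simp: eventually_sequentially)
  \<comment> \<open>Shifting by \<open>N\<close> is required because \<open>outer_limit\<close> asks
    for membership at every index.\<close>
  define xs where "xs k = xbar + t (\<sigma> (k + N)) *\<^sub>R q (\<sigma> (k + N))" for k
  define ys where "ys k = v - 2 *\<^sub>R (q (\<sigma> (k + N)) - p)" for k
  have "xs k \<in> {x \<in> X. f x > f xbar}" for k
    using N[of "k + N"] inX q(1) by (simp add: xs_def)
  moreover have "ys k \<in> frechet_subdiff X f (xs k)" for k
    unfolding xs_def ys_def using N[of "k + N"] q(2)
    by (intro frechet_subdiff_of_penalised_minimiser[OF t0]) (auto simp: \<phi>_def)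
  moreover have "xs \<longlonglongrightarrow> xbar + 0 *\<^sub>R q0"
    unfolding xs_def
    by (intro tendsto_intros LIMSEQ_ignore_initial_segment[OF t\<sigma>]
        LIMSEQ_ignore_initial_segment[OF q\<sigma>])
  moreover have "ys \<longlonglongrightarrow> v - 2 *\<^sub>R (q0 - p)"
    unfolding ys_def by (intro tendsto_intros LIMSEQ_ignore_initial_segment[OF q\<sigma>])
  ultimately show "v \<in> outer_limit {x \<in> X. f x > f xbar} xbar (frechet_subdiff X f)"
    unfolding outer_limit_def using \<open>q0 = p\<close> by auto
qed

end
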